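(* Let $y$ be the exact solution on $[t_0,T]$ of $y'=f(y)$, $y(t_0)=y_0$, and let $\{y_n\}$ and $\{\tilde y_n\}$ be the numerical solutions generated, with the same step size $\Delta t$, by two one-step methods $$y_{n+1}=y_n+\Delta t\,\Phi(t_n,y_n,\Delta t),\qquad \tilde y_{n+1}=\tilde y_n+\Delta t\,\tilde\Phi(t_n,\tilde y_n,\Delta t),\qquad t_n=t_0+n\Delta t,$$ started from the same exact initial condition $y_0=\tilde y_0=y(t_0)$, under the smoothness assumptions listed in the context. Suppose that there is a constant $\gamma\neq 1$ such that the local errors satisfy $$y(t+\Delta t)-y(t)-\Delta t\,\Phi(t,y(t),\Delta t)=d_{p+1}(t)\,\Delta t^{p+1}+\mathcal O(\Delta t^{p+2}),$$ $$y(t+\Delta t)-y(t)-\Delta t\,\tilde\Phi(t,y(t),\Delta t)=\gamma\, d_{p+1}(t)\,\Delta t^{p+1}+\mathcal O(\Delta t^{p+2}),$$ where $$d_{p+1}(t)=\frac{1}{(p+1)!}\sum_{\tau\in T_{p+1}}\alpha(\tau)\,a(\tau)\,F(\tau)(y(t))$$ for some real coefficients $a(\tau)$. Let $\varepsilon(t_n)=y(t_n)-y_n$ be the global error of the first method, and let $e_p$ be the solution of $$e_p'(t)=\frac{\partial f}{\partial y}(y(t))\,e_p(t)+d_{p+1}(t),\qquad e_p(t_0)=0 .$$ Then the global error can be estimated by $$\varepsilon_p(t_n):=\frac{1}{1-\gamma}\left(\tilde y_n-y_n\right)=e_p(t_n)\,\Delta t^p+\mathcal O(\Delta t^{p+1})=\varepsilon(t_n)+\mathcal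 O(\Delta t^{p+1}),$$ i.e. $\varepsilon_p(t_n)$ is an asymptotically correct estimate of $y(t_n)-y_n$.
   Context: Setting: the ODE is $y'=f(y)$, $y(t_0)=y_0\in\mathbb R^m$, $t_0<t\le T$, written in autonomous form (a nonautonomous system is made autonomous by adding $t$ as a component). $p\ge1$ is an integer, and $\mathcal O(\cdot)$ is as $\Delta t\to0$, uniformly for $t$ (respectively $t_n$) in $[t_0,T]$. Smoothness assumptions: $f$, $\Phi$ and $\tilde\Phi$ are sufficiently smooth (as often continuously differentiable as needed), $\Phi(t,y,0)=\tilde\Phi(t,y,0)=f(y)$, and there is a neighborhood $U$ of $\{(t,y(t)) : t_0\le t\le T\}$ and a constant $L$ such that $\|f(x)-f(z)\|\le L\|x-z\|$ for $(t,x),(t,z)\in U$, and in $U$ both methods satisfy the one-step bound that, when started on an exact solution, the error after one step is at most $C\Delta t^{p+1}$ for a constant $C$. Trees: $T_q$ is the set of (unlabeled) rooted trees with $q$ vertices; $\alpha(\tau)$ is the number of different monotonic labelings of $\tau$ (labelings of the vertices by $1<\dots<q$ increasing away from the root, counted up to tree isomorphism). The elementary differentials are $F(\bullet)(y)=f(y)$ and $F([\tau_1,\dots,\tau_k])(y)=f^{(k)}(y)\big(F(\tau_1)(y),\dots,F(\tau_k)(y)\big)$, where $[\tau_1,\dots,\tau_k]$ is the tree obtained by attaching the roots of $\tau_1,\dots,\tau_k$ to a new root. *)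

theory Defs
  imports "HOL-Analysis.Analysis" "HOL-Library.Multiset"
begin

section \<open>Differentiability classes and higher derivatives\<close>

text \<open>
  \<open>Ck_on k g S\<close>: \<open>g\<close> is \<open>k\<close> times continuously differentiable on \<open>S\<close>. In finite dimension,
  continuity of the derivative is equivalent to continuity of its value at each fixed vector.
  On an open \<open>S\<close> this is the usual notion; derivatives are taken within \<open>S\<close> so that
  it also covers \<open>S = U \<times> {0..h0}\<close> with \<open>U\<close> open, where they are one-sided in the last variable
  at the end points (and still unique).
\<close>

primrec Ck_on ::
  "nat \<Rightarrow> ('a::euclidean_space \<Rightarrow> 'b::euclidean_space) \<Rightarrow> 'a set \<Rightarrow> bool" where
  "Ck_on 0 g S \<longleftrightarrow> continuous_on S g"
| "Ck_on (Suc k) g S \<longleftrightarrow>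
     (\<exists>g'. (\<forall>x\<in>S. (g has_derivative g' x) (at x within S)) \<and> (\<forall>v. Ck_on k (\<lambda>x. g' x v) S))"

text \<open>
  \<open>kderiv g [v\<^sub>1, \<dots>, v\<^sub>k] x\<close> is \<open>g\<^sup>(\<^sup>k\<^sup>)(x)(v\<^sub>1, \<dots>, v\<^sub>k)\<close>: for \<open>g\<close> of class \<open>C\<^sup>k\<close> the \<open>k\<close>-th derivative is
  the (symmetric) iterated directional derivative.
\<close>

primrec kderiv ::
  "('a::euclidean_space \<Rightarrow> 'b::euclidean_space) \<Rightarrow> 'a list \<Rightarrow> 'a \<Rightarrow> 'b" where
  "kderiv g [] x = g x"
| "kderiv g (v # vs) x = frechet_derivative (\<lambda>z. kderiv g vs z) (at x) v"


section \<open>Rooted trees and elementary differentials\<close>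

text \<open>
  \<open>Node {#\<tau>\<^sub>1, \<dots>, \<tau>\<^sub>k#}\<close> is \<open>[\<tau>\<^sub>1, \<dots>, \<tau>\<^sub>k]\<close>; since the subtrees form a multiset, equality of
  values is isomorphism of unlabeled rooted trees. The one-vertex tree is \<open>Node {#}\<close>.
\<close>

datatype rtree = Node "rtree multiset"

primrec vertices :: "rtree \<Rightarrow> nat" where
  "vertices (Node M) = Suc (\<Sum>\<^sub># (image_mset vertices M))"

definition rooted_trees :: "nat \<Rightarrow> rtree set" where
  "rooted_trees q = {\<tau>. vertices \<tau> = q}"

text \<open>
  Rooted trees with labeled vertices, again up to (label-preserving) isomorphism.
\<close>

datatype ltree = LNode (root_label: nat) "ltree multiset"

primrec labels :: "ltree \<Rightarrow> nat multiset" where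
  "labels (LNode i M) = add_mset i (\<Sum>\<^sub># (image_mset labels M))"

primrec unlabeled :: "ltree \<Rightarrow> rtree" where
  "unlabeled (LNode i M) = Node (image_mset unlabeled M)"

inductive monotonic :: "ltree \<Rightarrow> bool" where
  "(\<And>s. s \<in># M \<Longrightarrow> i < root_label s \<and> monotonic s) \<Longrightarrow> monotonic (LNode i M)"

definition monotonic_labelings :: "rtree \<Rightarrow> ltree set" where
  "monotonic_labelings \<tau> =
     {t. unlabeled t = \<tau> \<and> labels t = mset_set {1..vertices \<tau>} \<and> monotonic t}"

definition alpha :: "rtree \<Rightarrow> nat" where
  "alpha \<tau> = card (monotonic_labelings \<tau>)"

text \<open>
  \<open>F(\<bullet>)(y) = f(y)\<close> and \<open>F([\<tau>\<^sub>1, \<dots>, \<tau>\<^sub>k])(y) = f\<^sup>(\<^sup>k\<^sup>)(y)(F(\<tau>\<^sub>1)(y), \<dots>, F(\<tau>\<^sub>k)(y))\<close>. The derivative takes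
  its arguments as a list, the subtrees come as a multiset, so some enumeration of the functions
  \<open>F(\<tau>\<^sub>i)\<close> (independent of \<open>y\<close>) is chosen; by symmetry of \<open>f\<^sup>(\<^sup>k\<^sup>)(y)\<close> the choice is immaterial.
\<close>

primrec elem_diff :: "('a::euclidean_space \<Rightarrow> 'a) \<Rightarrow> rtree \<Rightarrow> 'a \<Rightarrow> 'a" where
  "elem_diff f (Node M) =
     (\<lambda>y. kderiv f (map (\<lambda>F. F y) (SOME Fs. mset Fs = image_mset (elem_diff f) M)) y)"

text \<open>
  Sums and cardinalities over infinite sets are \<open>0\<close> by convention; the finiteness lemmas below show
  that this does not happen here.
\<close>

lemma vertices_pos: "vertices \<tau> > 0"
  by (cases \<tau>) simp

lemma size_le_sum_vertices: "size M \<le> \<Sum>\<^sub># (image_mset vertices M)"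
proof (induction M)
  case (add x M)
  then show ?case using vertices_pos[of x] by simp
qed simp

lemma finite_bounded_msets:
  assumes "finite A" shows "finite {M. set_mset M \<subseteq> A \<and> size M \<le> n}"
proof -
  have "{M. set_mset M \<subseteq> A \<and> size M \<le> n} = (\<Union>k\<le>n. multisets_of_size A k)"
    by (auto simp: multisets_of_size_def)
  with assms show ?thesis by auto
qed

lemma finite_rooted_trees: "finite (rooted_trees q)"
proof -
  have "finite {\<tau>. vertices \<tau> \<le> n}" for n
  proof (induction n)
    case 0
    show ?case by (simp add: vertices_pos[THEN gr_implies_not0])
  next
    case (Suc n)
    have "{\<tau>. vertices \<tau> \<le> Suc n} \<subseteq> Node ` {M. set_mset M \<subseteq> {\<tau>. vertices \<tau> \<le> n} \<and> size M \<le> n}"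
    proof
      fix \<tau> assume \<tau>: "\<tau> \<in> {\<tau>. vertices \<tau> \<le> Suc n}"
      obtain M where M: "\<tau> = Node M" by (cases \<tau>)
      with \<tau> have le: "\<Sum>\<^sub># (image_mset vertices M) \<le> n" by simp
      have "vertices s \<le> n" if "s \<in># M" for s
        using that le by (auto dest!: multi_member_split)
      moreover have "size M \<le> n" using le size_le_sum_vertices[of M] by linarith
      ultimately show "\<tau> \<in> Node ` {M. set_mset M \<subseteq> {\<tau>. vertices \<tau> \<le> n} \<and> size M \<le> n}"
        using M by auto
    qed
    then show ?case by (rule finite_subset) (intro finite_imageI finite_bounded_msets Suc.IH)
  qed
  from this[of q] show ?thesis by (rule rev_finite_subset) (auto simp: rooted_trees_def)
qed

lemma size_labels: "size (labels t) = vertices (unlabeled t)"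
proof (induction t)
  case (LNode i M)
  then have "size (\<Sum>\<^sub># (image_mset labels M)) = \<Sum>\<^sub># (image_mset (\<lambda>t. vertices (unlabeled t)) M)"
    by (induction M) auto
  then show ?case by (simp add: image_mset.compositionality o_def)
qed

lemma finite_monotonic_labelings: "finite (monotonic_labelings \<tau>)"
proof -
  let ?A = "{1..vertices \<tau>}"
  let ?S = "\<lambda>n. {t. set_mset (labels t) \<subseteq> ?A \<and> vertices (unlabeled t) \<le> n}"
  have "finite (?S n)" for n
  proof (induction n)
    case 0
    show ?case by (simp add: vertices_pos[THEN gr_implies_not0])
  next
    case (Suc n)
    let ?B = "{M. set_mset M \<subseteq> ?S n \<and> size M \<le> n}"
    have "?S (Suc n) \<subseteq> (\<lambda>(i, M). LNode i M) ` (?A \<times> ?B)"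
    proof
      fix t assume t: "t \<in> ?S (Suc n)"
      obtain i M where M: "t = LNode i M" by (cases t)
      have i: "i \<in> ?A" using t M by simp
      have le: "\<Sum>\<^sub># (image_mset vertices (image_mset unlabeled M)) \<le> n" using t M by simp
      have "s \<in> ?S n" if s: "s \<in># M" for s
        using multi_member_split[OF s] le t M by auto
      moreover have "size M \<le> n"
        using le size_le_sum_vertices[of "image_mset unlabeled M"] by simp
      ultimately show "t \<in> (\<lambda>(i, M). LNode i M) ` (?A \<times> ?B)"
        using M i by (intro image_eqI[of _ _ "(i, M)"]) auto
    qed
    then show ?case
      by (rule finite_subset) (intro finite_imageI finite_cartesian_product finite_bounded_msets
          Suc.IH finite_atLeastAtMost)
  qed
  from this[of "vertices \<tau>"] show ?thesis
    by (rule rev_finite_subset) (auto simp: monotonic_labelings_def)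
qed


section \<open>Differential equations and one-step methods\<close>

definition solves_ode :: "(real \<Rightarrow> 'a::euclidean_space) \<Rightarrow> (real \<Rightarrow> 'a \<Rightarrow> 'a) \<Rightarrow> real \<Rightarrow> real \<Rightarrow> bool" where
  "solves_ode z g s T \<longleftrightarrow>
     (\<forall>t\<in>{s..T}. (z has_vector_derivative g t (z t)) (at t within {s..T}))"

primrec one_step ::
  "(real \<Rightarrow> 'a::euclidean_space \<Rightarrow> real \<Rightarrow> 'a) \<Rightarrow> real \<Rightarrow> 'a \<Rightarrow> real \<Rightarrow> nat \<Rightarrow> 'a" where
  "one_step \<Phi> t0 y0 h 0 = y0"
| "one_step \<Phi> t0 y0 h (Suc n) =
     one_step \<Phi> t0 y0 h n + h *\<^sub>R \<Phi> (t0 + real n * h) (one_step \<Phi> t0 y0 h n) h"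

text \<open>
  An increment function on \<open>U\<close> with step sizes in \<open>[0, h0]\<close> that is of class \<open>C\<^sup>k\<close>,
  consistent with \<open>f\<close>, and whose error after one step from any exact solution running
  in \<open>U\<close> is at most \<open>C h\<^sup>p\<^sup>+\<^sup>1\<close>.
\<close>

definition admissible_method ::
  "(real \<times> 'a::euclidean_space) set \<Rightarrow> real \<Rightarrow> ('a \<Rightarrow> 'a) \<Rightarrow> nat \<Rightarrow> nat \<Rightarrow>
     (real \<Rightarrow> 'a \<Rightarrow> real \<Rightarrow> 'a) \<Rightarrow> bool" where
  "admissible_method U h0 f k p \<Phi> \<longleftrightarrow>
     Ck_on k (\<lambda>(t, x, h). \<Phi> t x h) {(t, x, h). (t, x) \<in> U \<and> 0 \<le> h \<and> h \<le> h0} \<and>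
     (\<forall>(t, x)\<in>U. \<Phi> t x 0 = f x) \<and>
     (\<exists>C. \<forall>s h z. 0 < h \<longrightarrow> h \<le> h0 \<longrightarrow> solves_ode z (\<lambda>_. f) s (s + h) \<longrightarrow>
        (\<forall>t\<in>{s..s + h}. (t, z t) \<in> U) \<longrightarrow>
        norm (z (s + h) - (z s + h *\<^sub>R \<Phi> s (z s) h)) \<le> C * h ^ (p + 1))"

end

theory Submission
  imports Defs
begin

text \<open>
  For either method, with leading local error term \<open>d\<close> or \<open>\<gamma> d\<close>, the corrected solution
  \<open>w\<^sub>n = y(t\<^sub>n) - h\<^sup>p e(t\<^sub>n)\<close>, respectively \<open>y(t\<^sub>n) - h\<^sup>p \<gamma> e(t\<^sub>n)\<close>, satisfies the recursion of the method
  up to a residual \<open>O(h\<^sup>p\<^sup>+\<^sup>2)\<close>: the equation for \<open>e\<close> is what makes the terms of order \<open>h\<^sup>p\<^sup>+\<^sup>1\<close> cancel, given that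
  \<open>\<Phi>(t,x,h) - \<Phi>(t,y(t),h) = f'(y(t))(x - y(t)) + O((|x - y(t)| + h) |x - y(t)|)\<close> and \<open>2p \<ge> p + 1\<close>.
  Lipschitz stability of the method turns this into \<open>y\<^sub>n = w\<^sub>n + O(h\<^sup>p\<^sup>+\<^sup>1)\<close>, and subtracting the two
  expansions leaves \<open>(1 - \<gamma>) e(t\<^sub>n) h\<^sup>p\<close>. The Taylor remainder of \<open>e\<close> is only \<open>O(h\<^sup>2)\<close> if \<open>e'\<close>, hence \<open>d\<close>,
  is Lipschitz; this is where the formula for \<open>d\<close> enters: a tree with \<open>p + 1\<close> vertices involves derivatives
  of \<open>f\<close> of order at most \<open>p\<close>, so \<open>d\<close> is continuously differentiable for \<open>f\<close> of class \<open>C\<^sup>p\<^sup>+\<^sup>1\<close>.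
\<close>

section \<open>Continuously differentiable functions\<close>

text \<open>A derivative within \<open>S\<close> depends only on the values on \<open>S\<close>, so
  the same witness \<open>g'\<close> serves both functions and a case split replaces
  induction.\<close>

lemma Ck_on_cong:
  assumes "\<And>x. x \<in> S \<Longrightarrow> g x = h x"
  shows "Ck_on k g S \<longleftrightarrow> Ck_on k h S"
proof (cases k)
  case 0
  then show ?thesis using assms by (simp cong: continuous_on_cong)
next
  case (Suc m)
  have "(g has_derivative D) (at x within S) \<longleftrightarrow> (h has_derivative D) (at x within S)"
    if "x \<in> S" for x D
    using has_derivative_transform[OF that, of g h] has_derivative_transform[OF that, of h g] assms
    by metis
  then show ?thesis using Suc by simp
qed

lemma Ck_on_transform:
  "Ck_on k h S \<Longrightarrow> (\<And>x. x \<in> S \<Longrightarrow> g x = h x) \<Longrightarrow> Ck_on k g S"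
  using Ck_on_cong by blast

lemma Ck_on_SucD: "Ck_on (Suc k) g S \<Longrightarrow> Ck_on k g S"
proof (induction k arbitrary: g)
  case 0
  then show ?case
    by (auto simp: continuous_on_eq_continuous_within intro: has_derivative_continuous)
next
  case (Suc k)
  then obtain g' where "\<forall>x\<in>S. (g has_derivative g' x) (at x within S)"
    "\<forall>v. Ck_on (Suc k) (\<lambda>x. g' x v) S"
    by auto
  with Suc.IH show ?case by auto
qed

lemma Ck_on_le: "Ck_on n g S \<Longrightarrow> k \<le> n \<Longrightarrow> Ck_on k g S"
  by (induction n) (auto simp: le_Suc_eq simp del: Ck_on.simps dest: Ck_on_SucD)

lemma C1_onI:
  assumes "\<And>x. x \<in> S \<Longrightarrow> (g has_derivative g' x) (at x within S)"
    and "\<And>v. continuous_on S (\<lambda>x. g' x v)"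
  shows "Ck_on 1 g S"
  using assms by auto

lemma C1_onE:
  assumes "Ck_on 1 g S"
  obtains g' where "\<And>x. x \<in> S \<Longrightarrow> (g has_derivative g' x) (at x within S)"
    and "\<And>v. continuous_on S (\<lambda>x. g' x v)"
  using assms by auto

lemma C1_on_imp_continuous_on: "Ck_on 1 g S \<Longrightarrow> continuous_on S g"
  using Ck_on_SucD[of 0 g S] by simp

text \<open>Used to read off the smoothness of \<open>y\<close> and \<open>e\<close> from their
  differential equations.\<close>

lemma C1_on_vector_derivative:
  assumes "\<And>t. t \<in> S \<Longrightarrow> (g has_vector_derivative g' t) (at t within S)"
    and "continuous_on S g'"
  shows "Ck_on 1 g S"
  using assms unfolding has_vector_derivative_def
  by (intro C1_onI[where g' = "\<lambda>t v. v *\<^sub>R g' t"]) (auto intro!: continuous_intros)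

text \<open>\<open>Ck_on\<close> controls a derivative only along fixed vectors. Expanding a moving
  direction in the basis turns it into scalar coefficients in front of derivatives along fixed
  vectors.\<close>

lemma linear_Basis_expansion:
  fixes g :: "'a::euclidean_space \<Rightarrow> 'b::real_vector"
  assumes "linear g"
  shows "g v = (\<Sum>b\<in>Basis. (v \<bullet> b) *\<^sub>R g b)"
proof -
  have "g v = g (\<Sum>b\<in>Basis. (v \<bullet> b) *\<^sub>R b)" by (simp add: euclidean_representation)
  also have "\<dots> = (\<Sum>b\<in>Basis. (v \<bullet> b) *\<^sub>R g b)"
    using assms by (simp add: linear_sum linear_scale)
  finally show ?thesis .
qed

section \<open>Closure properties of continuously differentiable functions\<close>

lemma C1_on_const: "Ck_on 1 (\<lambda>_. c) S"
  by (rule C1_onI[where g' = "\<lambda>_ _. 0"]) auto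

lemma C1_on_add:
  assumes "Ck_on 1 g S" "Ck_on 1 h S"
  shows "Ck_on 1 (\<lambda>x. g x + h x) S"
proof -
  obtain g' h' where "\<And>x. x \<in> S \<Longrightarrow> (g has_derivative g' x) (at x within S)"
    "\<And>v. continuous_on S (\<lambda>x. g' x v)"
    "\<And>x. x \<in> S \<Longrightarrow> (h has_derivative h' x) (at x within S)"
    "\<And>v. continuous_on S (\<lambda>x. h' x v)"
    using assms by (elim C1_onE) (rule that)
  then show ?thesis
    by (intro C1_onI[where g' = "\<lambda>x v. g' x v + h' x v"])
      (auto intro!: derivative_intros continuous_intros)
qed

lemma C1_on_sum:
  assumes "\<And>i. i \<in> I \<Longrightarrow> Ck_on 1 (g i) S"
  shows "Ck_on 1 (\<lambda>x. \<Sum>i\<in>I. g i x) S"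
  using assms
  by (induction I rule: infinite_finite_induct)
    (simp_all add: C1_on_const C1_on_add del: Ck_on.simps One_nat_def)

lemma C1_on_scaleR:
  assumes "Ck_on 1 g S" "Ck_on 1 h S"
  shows "Ck_on 1 (\<lambda>x. g x *\<^sub>R h x) S"
proof -
  obtain g' h' where "\<And>x. x \<in> S \<Longrightarrow> (g has_derivative g' x) (at x within S)"
    "\<And>v. continuous_on S (\<lambda>x. g' x v)"
    "\<And>x. x \<in> S \<Longrightarrow> (h has_derivative h' x) (at x within S)"
    "\<And>v. continuous_on S (\<lambda>x. h' x v)"
    using assms by (elim C1_onE) (rule that)
  then show ?thesis using assms[THEN C1_on_imp_continuous_on]
    by (intro C1_onI[where g' = "\<lambda>x v. g x *\<^sub>R h' x v + g' x v *\<^sub>R h x"])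
      (auto intro!: derivative_intros continuous_intros)
qed

lemma C1_on_inner_const:
  assumes "Ck_on 1 g S"
  shows "Ck_on 1 (\<lambda>x. g x \<bullet> b) S"
proof -
  obtain g' where "\<And>x. x \<in> S \<Longrightarrow> (g has_derivative g' x) (at x within S)"
    "\<And>v. continuous_on S (\<lambda>x. g' x v)"
    using assms by (elim C1_onE) (rule that)
  then show ?thesis
    by (intro C1_onI[where g' = "\<lambda>x v. g' x v \<bullet> b"])
      (auto intro!: derivative_intros continuous_intros)
qed

lemma C1_on_compose:
  assumes "Ck_on 1 g S" "Ck_on 1 h R" "h ` R \<subseteq> S"
  shows "Ck_on 1 (\<lambda>x. g (h x)) R"
proof -
  obtain g' h' where g': "\<And>x. x \<in> S \<Longrightarrow> (g has_derivative g' x) (at x within S)"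
    "\<And>v. continuous_on S (\<lambda>x. g' x v)"
    and h': "\<And>x. x \<in> R \<Longrightarrow> (h has_derivative h' x) (at x within R)"
    "\<And>v. continuous_on R (\<lambda>x. h' x v)"
    using assms by (elim C1_onE) (rule that)
  have der: "((\<lambda>x. g (h x)) has_derivative (\<lambda>v. g' (h x) (h' x v))) (at x within R)"
    if "x \<in> R" for x
    by (rule has_derivative_in_compose2[OF g'(1) assms(3) that h'(1)[OF that]])
  \<comment> \<open>The direction \<open>h' x v\<close> moves with \<open>x\<close>, so continuity
    is obtained for the basis expansion of \<open>g' (h x) (h' x v)\<close>.\<close>
  have "continuous_on R (\<lambda>x. \<Sum>b\<in>Basis. (h' x v \<bullet> b) *\<^sub>R g' (h x) b)" for v
    by (intro continuous_intros h'(2)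
        continuous_on_compose2[OF g'(2) C1_on_imp_continuous_on[OF assms(2)] assms(3)])
  moreover have "g' (h x) (h' x v) = (\<Sum>b\<in>Basis. (h' x v \<bullet> b) *\<^sub>R g' (h x) b)"
    if "x \<in> R" for x v
    using g'(1) assms(3) that by (intro linear_Basis_expansion) (auto dest: has_derivative_linear)
  ultimately have "continuous_on R (\<lambda>x. g' (h x) (h' x v))" for v
    by (simp cong: continuous_on_cong)
  with der show ?thesis by (intro C1_onI) auto
qed

text \<open>Mean value inequality on each convex piece, with one constant for all pieces because the
  partial derivatives are bounded on the compact \<open>K\<close>. \<open>K\<close> itself need not
  be convex, which matters for tubes around a curve.\<close>

lemma C1_on_uniform_lipschitz:
  assumes "Ck_on 1 g S" "compact K" "K \<subseteq> S"
  obtains B where "B \<ge> 0"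
    "\<And>C x z. convex C \<Longrightarrow> C \<subseteq> K \<Longrightarrow> x \<in> C \<Longrightarrow> z \<in> C \<Longrightarrow> norm (g x - g z) \<le> B * norm (x - z)"
proof -
  obtain g' where g': "\<And>x. x \<in> S \<Longrightarrow> (g has_derivative g' x) (at x within S)"
    "\<And>v. continuous_on S (\<lambda>x. g' x v)"
    using assms(1) by (elim C1_onE) (rule that)
  have "\<exists>c. \<forall>x\<in>K. norm (g' x b) \<le> c" for b
  proof -
    have "compact ((\<lambda>x. g' x b) ` K)"
      by (rule compact_continuous_image[OF continuous_on_subset[OF g'(2) assms(3)] assms(2)])
    then show ?thesis by (auto dest!: compact_imp_bounded simp: bounded_iff)
  qed
  then obtain c where c: "\<And>b x. x \<in> K \<Longrightarrow> norm (g' x b) \<le> c b" by metis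
  \<comment> \<open>The absolute values make \<open>B\<close> nonnegative even for empty
    \<open>K\<close>, when \<open>c\<close> is arbitrary.\<close>
  define B where "B = (\<Sum>b\<in>Basis. \<bar>c b\<bar>)"
  have on: "onorm (g' x) \<le> B" if "x \<in> K" for x
  proof (rule onorm_bound)
    fix v
    have "norm (g' x v) = norm (\<Sum>b\<in>Basis. (v \<bullet> b) *\<^sub>R g' x b)"
      using g'(1) assms(3) that
      by (subst linear_Basis_expansion[of "g' x" v]) (auto dest: has_derivative_linear)
    also have "\<dots> \<le> (\<Sum>b\<in>Basis. norm v * \<bar>c b\<bar>)"
      using order_trans[OF c[OF that] abs_ge_self]
      by (intro sum_norm_le) (auto intro!: mult_mono Basis_le_norm)
    also have "\<dots> = B * norm v" by (simp add: B_def sum_distrib_left mult.commute)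
    finally show "norm (g' x v) \<le> B * norm v" .
  qed (simp add: B_def sum_nonneg)
  show thesis
  proof
    show "B \<ge> 0" by (simp add: B_def sum_nonneg)
    fix C x z assume "convex C" "C \<subseteq> K" "x \<in> C" "z \<in> C"
    then show "norm (g x - g z) \<le> B * norm (x - z)"
      using g'(1) assms(3) on
      by (intro differentiable_bound[where f' = g' and S = C])
        (auto intro: has_derivative_subset)
  qed
qed

section \<open>Smoothness of elementary differentials\<close>

text \<open>On an open set the derivative is unique, so the witness hidden in \<open>Ck_on\<close>
  is the \<open>frechet_derivative\<close> from which \<open>kderiv\<close> is built.\<close>

lemma Ck_on_frechet_derivative:
  assumes "open S" "Ck_on (Suc k) g S"
  shows "Ck_on k (\<lambda>x. frechet_derivative g (at x) v) S"
proof -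
  obtain g' where g': "\<forall>x\<in>S. (g has_derivative g' x) (at x within S)" "\<forall>v. Ck_on k (\<lambda>x. g' x v) S"
    using assms by auto
  have "frechet_derivative g (at x) v = g' x v" if "x \<in> S" for x
    using g'(1) assms(1) that frechet_derivative_at at_within_open by metis
  with g'(2) show ?thesis by (simp cong: Ck_on_cong)
qed

lemma Ck_on_differentiable:
  assumes "open S" "Ck_on (Suc k) g S" "x \<in> S"
  shows "g differentiable (at x)"
proof -
  obtain D where "(g has_derivative D) (at x within S)" using assms by auto
  then show ?thesis using assms by (auto simp: at_within_open[of x S] differentiable_def)
qed

lemma Ck_on_kderiv:
  assumes "open S" "Ck_on n f S" "length vs \<le> n"
  shows "Ck_on (n - length vs) (kderiv f vs) S"
  using assms(3)
proof (induction vs)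
  case Nil
  have "kderiv f [] = f" by (simp add: fun_eq_iff)
  with assms(2) show ?case by simp
next
  case (Cons v vs)
  then have "n - length vs = Suc (n - length (v # vs))" by simp
  with Cons Ck_on_frechet_derivative[OF assms(1), of "n - length (v # vs)" "kderiv f vs" v]
  show ?case by (simp del: Ck_on.simps)
qed

lemma kderiv_differentiable:
  assumes "open S" "Ck_on n f S" "length vs < n" "x \<in> S"
  shows "kderiv f vs differentiable (at x)"
proof (rule Ck_on_differentiable[OF assms(1) _ assms(4)])
  have "n - length vs = Suc (n - Suc (length vs))" using assms by simp
  then show "Ck_on (Suc (n - Suc (length vs))) (kderiv f vs) S"
    using Ck_on_kderiv[OF assms(1,2), of vs] assms(3) by simp
qed

text \<open>With \<open>us\<close> empty, this is linearity of the Frechet derivative. Otherwise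
  both sides, by induction, agree on the open set \<open>S\<close> before the outermost
  differentiation, hence have the same derivative. The strict bound leaves room for the slot of
  \<open>v\<close>.\<close>

lemma kderiv_Basis_expansion:
  assumes "open S" "Ck_on n f S" "length us + length ws < n" "x \<in> S"
  shows "kderiv f (us @ v # ws) x = (\<Sum>b\<in>Basis. (v \<bullet> b) *\<^sub>R kderiv f (us @ b # ws) x)"
  using assms(3,4)
proof (induction us arbitrary: x)
  case Nil
  then have "linear (frechet_derivative (kderiv f ws) (at x))"
    using kderiv_differentiable[OF assms(1,2)] by (intro linear_frechet_derivative) auto
  from linear_Basis_expansion[OF this, of v] show ?case by (simp add: eta_contract_eq)
next
  case (Cons u us)
  let ?g = "\<lambda>z. \<Sum>b\<in>Basis. (v \<bullet> b) *\<^sub>R kderiv f (us @ b # ws) z"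
  have "(kderiv f (us @ b # ws) has_derivative frechet_derivative (kderiv f (us @ b # ws)) (at x)) (at x)" for b
    using Cons.prems kderiv_differentiable[OF assms(1,2), of "us @ b # ws"]
    by (auto simp: frechet_derivative_works)
  then have "(?g has_derivative
      (\<lambda>u. \<Sum>b\<in>Basis. (v \<bullet> b) *\<^sub>R frechet_derivative (kderiv f (us @ b # ws)) (at x) u)) (at x)"
    by (intro derivative_intros) auto
  then have "(kderiv f (us @ v # ws) has_derivative
      (\<lambda>u. \<Sum>b\<in>Basis. (v \<bullet> b) *\<^sub>R frechet_derivative (kderiv f (us @ b # ws)) (at x) u)) (at x)"
    by (rule has_derivative_transform_within_open[OF _ assms(1) Cons.prems(2)])
      (use Cons.IH Cons.prems in simp)
  from frechet_derivative_at[OF this, symmetric] show ?case by (simp add: eta_contract_eq)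
qed

text \<open>The list \<open>us\<close> accumulates frozen directions: each moving argument
  \<open>F x\<close> is expanded in the basis, and the basis vector joins \<open>us\<close>. When no
  moving argument is left, an order below \<open>n\<close> leaves one derivative to spare.\<close>

lemma C1_on_kderiv_map:
  assumes "open S" "Ck_on n f S" "length us + length Fs < n"
    and "\<And>F. F \<in> set Fs \<Longrightarrow> Ck_on 1 F S"
  shows "Ck_on 1 (\<lambda>x. kderiv f (us @ map (\<lambda>F. F x) Fs) x) S"
  using assms(3,4)
proof (induction Fs arbitrary: us)
  case Nil
  then show ?case
    using Ck_on_le[OF Ck_on_kderiv[OF assms(1,2), of us], of 1]
    by (simp add: eta_contract_eq del: Ck_on.simps)
next
  case (Cons F Fs)
  have "Ck_on 1 (\<lambda>x. kderiv f ((us @ [b]) @ map (\<lambda>F. F x) Fs) x) S" for b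
    using Cons.prems by (intro Cons.IH) (auto simp del: Ck_on.simps One_nat_def)
  then have "Ck_on 1 (\<lambda>x. \<Sum>b\<in>Basis. (F x \<bullet> b) *\<^sub>R kderiv f (us @ b # map (\<lambda>F. F x) Fs) x) S"
    using Cons.prems
    by (intro C1_on_sum C1_on_scaleR C1_on_inner_const) (auto simp del: Ck_on.simps One_nat_def)
  moreover have "kderiv f (us @ map (\<lambda>F. F x) (F # Fs)) x =
      (\<Sum>b\<in>Basis. (F x \<bullet> b) *\<^sub>R kderiv f (us @ b # map (\<lambda>F. F x) Fs) x)" if "x \<in> S" for x
    using Cons.prems that kderiv_Basis_expansion[OF assms(1,2), of us "map (\<lambda>F. F x) Fs"] by simp
  ultimately show ?case by (simp cong: Ck_on_cong del: Ck_on.simps One_nat_def)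
qed

text \<open>A root with \<open>k\<close> children uses the derivative of \<open>f\<close> of order
  \<open>k\<close>; one more order makes it continuously differentiable, and \<open>k + 1\<close> is
  at most the number of vertices. The subtrees are covered by induction.\<close>

lemma C1_on_elem_diff:
  assumes "open S" "Ck_on n f S" "vertices \<tau> \<le> n"
  shows "Ck_on 1 (elem_diff f \<tau>) S"
  using assms(3)
proof (induction \<tau>)
  case (Node M)
  define Fs where "Fs = (SOME Fs. mset Fs = image_mset (elem_diff f) M)"
  have Fs: "mset Fs = image_mset (elem_diff f) M"
    unfolding Fs_def by (rule someI_ex) (rule ex_mset)
  have "Ck_on 1 F S" if "F \<in> set Fs" for F
  proof -
    have "F \<in># mset Fs" using that by simp
    then obtain s where s: "s \<in># M" "F = elem_diff f s" unfolding Fs by auto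
    moreover have "vertices s \<le> n" using multi_member_split[OF s(1)] Node.prems by auto
    ultimately show ?thesis using Node.IH by blast
  qed
  moreover have "length Fs < n"
    using Node.prems size_le_sum_vertices[of M] arg_cong[OF Fs, of size] by simp
  ultimately have "Ck_on 1 (\<lambda>x. kderiv f ([] @ map (\<lambda>F. F x) Fs) x) S"
    by (intro C1_on_kderiv_map[OF assms(1,2)]) auto
  then show ?case by (simp add: Fs_def del: Ck_on.simps One_nat_def)
qed

section \<open>Asymptotic expansion of the global error\<close>

text \<open>Discrete Gronwall argument: each step multiplies the error by at most
  \<open>1 + h * \<Lambda>\<close> and adds at most \<open>\<rho>\<close>. The Lipschitz bound holds
  only within distance \<open>s\<close> of \<open>w n\<close>; \<open>tube\<close> lets the
  induction certify that the numerical solution stays there. The factor \<open>real n\<close>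
  replaces a geometric sum and avoids division by \<open>\<Lambda>\<close>.\<close>

lemma one_step_stability:
  assumes "h \<ge> 0" "\<Lambda> \<ge> 0" "\<rho> \<ge> 0" "w 0 = y0"
    and residual: "\<And>n. n < N \<Longrightarrow>
      norm (w (Suc n) - w n - h *\<^sub>R \<Phi> (t0 + real n * h) (w n) h) \<le> \<rho>"
    and lipschitz: "\<And>n x. n < N \<Longrightarrow> norm (w n - x) \<le> s \<Longrightarrow>
      norm (\<Phi> (t0 + real n * h) (w n) h - \<Phi> (t0 + real n * h) x h) \<le> \<Lambda> * norm (w n - x)"
    and tube: "real N * \<rho> * (1 + h * \<Lambda>) ^ N \<le> s"
    and "n \<le> N"
  shows "norm (w n - one_step \<Phi> t0 y0 h n) \<le> real n * \<rho> * (1 + h * \<Lambda>) ^ n"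
  using \<open>n \<le> N\<close>
proof (induction n)
  case 0
  then show ?case using assms by simp
next
  case (Suc n)
  let ?u = "one_step \<Phi> t0 y0 h" and ?F = "\<lambda>x. \<Phi> (t0 + real n * h) x h" and ?q = "1 + h * \<Lambda>"
  have q: "?q \<ge> 1" using assms by simp
  have IH: "norm (w n - ?u n) \<le> real n * \<rho> * ?q ^ n" using Suc by simp
  also have "\<dots> \<le> real N * \<rho> * ?q ^ N"
    using Suc.prems q assms(3) by (intro mult_mono power_increasing) auto
  also have "\<dots> \<le> s" by (rule tube)
  finally have lip: "norm (?F (w n) - ?F (?u n)) \<le> \<Lambda> * norm (w n - ?u n)"
    using Suc.prems by (intro lipschitz) auto
  have "w (Suc n) - ?u (Suc n) =
      (w n - ?u n) + h *\<^sub>R (?F (w n) - ?F (?u n)) + (w (Suc n) - w n - h *\<^sub>R ?F (w n))"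
    by (simp add: algebra_simps)
  then have "norm (w (Suc n) - ?u (Suc n)) \<le>
      norm (w n - ?u n) + norm (h *\<^sub>R (?F (w n) - ?F (?u n))) + norm (w (Suc n) - w n - h *\<^sub>R ?F (w n))"
    by (metis norm_triangle_le norm_triangle_ineq add_right_mono)
  also have "\<dots> \<le> norm (w n - ?u n) + h * (\<Lambda> * norm (w n - ?u n)) + \<rho>"
    using lip residual[of n] Suc.prems assms(1) by (intro add_mono) (auto intro: mult_left_mono)
  also have "\<dots> = norm (w n - ?u n) * ?q + \<rho>" by (simp add: algebra_simps)
  \<comment> \<open>Enlarging the new residual by \<open>?q ^ Suc n\<close>, which is at least
    \<open>1\<close>, makes it one more equal summand beside the previous \<open>n\<close>.\<close>
  also have "\<dots> \<le> real n * \<rho> * ?q ^ n * ?q + \<rho> * ?q ^ Suc n"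
  proof (intro add_mono mult_right_mono IH)
    show "\<rho> \<le> \<rho> * ?q ^ Suc n"
      using q assms(3) one_le_power[of ?q "Suc n"] by (simp add: mult_le_cancel_left1 del: power_Suc)
  qed (use q in simp)
  also have "\<dots> = real (Suc n) * \<rho> * ?q ^ Suc n" by (simp add: algebra_simps)
  finally show ?case .
qed

section \<open>Uniform estimates on a compact tube around the exact solution\<close>

lemma obtain_tube:
  fixes y :: "real \<Rightarrow> 'a::euclidean_space"
  assumes "continuous_on {t0..T} y" "open U" "\<And>t. t \<in> {t0..T} \<Longrightarrow> (t, y t) \<in> U"
  obtains r where "r > 0" "\<And>t x. t \<in> {t0..T} \<Longrightarrow> norm (x - y t) \<le> r \<Longrightarrow> (t, x) \<in> U"
proof -
  have "compact ((\<lambda>t. (t, y t)) ` {t0..T})"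
    using assms(1) by (intro compact_continuous_image continuous_intros) auto
  then obtain r where r: "r > 0" "(\<Union>z\<in>(\<lambda>t. (t, y t)) ` {t0..T}. cball z r) \<subseteq> U"
    using assms by (elim compact_subset_open_imp_cball_epsilon_subset) auto
  have "(t, x) \<in> U" if "t \<in> {t0..T}" "norm (x - y t) \<le> r" for t x
  proof -
    have "(t, x) \<in> cball (t, y t) r"
      using that by (simp add: dist_Pair_Pair dist_norm norm_minus_commute)
    then show ?thesis using r(2) that(1) by blast
  qed
  with r(1) show thesis by (rule that)
qed

text \<open>The tube is the image of a compact product under the shift of the state by
  \<open>y t\<close>.\<close>

lemma compact_tube:
  fixes y :: "real \<Rightarrow> 'a::euclidean_space"
  assumes "continuous_on {t0..T} y"
  shows "compact {(t, x, h). t \<in> {t0..T} \<and> norm (x - y t) \<le> r \<and> h \<in> {0..h0::real}}"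
proof -
  let ?S = "{t0..T} \<times> cball 0 r \<times> {0..h0}"
  have "{(t, x, h). t \<in> {t0..T} \<and> norm (x - y t) \<le> r \<and> h \<in> {0..h0}} =
      (\<lambda>z. (fst z, y (fst z) + fst (snd z), snd (snd z))) ` ?S"
    by (force simp: image_iff)
  moreover have "continuous_on ?S (\<lambda>z. (fst z, y (fst z) + fst (snd z), snd (snd z)))"
    by (intro continuous_intros continuous_on_compose2[OF assms]) auto
  ultimately show ?thesis
    by (simp add: compact_continuous_image compact_Times)
qed

text \<open>The time \<open>t\<close> is common to both points because the tube need not be convex,
  whereas its slice at one time is a product of a point, a ball and an interval.\<close>

lemma C1_on_tube_lipschitz:
  fixes y :: "real \<Rightarrow> 'a::euclidean_space"
    and g :: "real \<times> 'a \<times> real \<Rightarrow> 'b::euclidean_space"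
  assumes "continuous_on {t0..T} y"
    and "\<And>t x. t \<in> {t0..T} \<Longrightarrow> norm (x - y t) \<le> r \<Longrightarrow> (t, x) \<in> U"
    and "Ck_on 1 g {(t, x, h). (t, x) \<in> U \<and> 0 \<le> h \<and> h \<le> h0}"
  obtains \<Lambda> where "\<Lambda> \<ge> 0"
    "\<And>t x z h k. t \<in> {t0..T} \<Longrightarrow> norm (x - y t) \<le> r \<Longrightarrow> norm (z - y t) \<le> r \<Longrightarrow>
       h \<in> {0..h0} \<Longrightarrow> k \<in> {0..h0} \<Longrightarrow>
       norm (g (t, x, h) - g (t, z, k)) \<le> \<Lambda> * (norm (x - z) + \<bar>h - k\<bar>)"
proof -
  let ?K = "{(t, x, h). t \<in> {t0..T} \<and> norm (x - y t) \<le> r \<and> h \<in> {0..h0}}"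
  obtain \<Lambda> where \<Lambda>: "\<Lambda> \<ge> 0"
    "\<And>C x z. convex C \<Longrightarrow> C \<subseteq> ?K \<Longrightarrow> x \<in> C \<Longrightarrow> z \<in> C \<Longrightarrow> norm (g x - g z) \<le> \<Lambda> * norm (x - z)"
    by (rule C1_on_uniform_lipschitz[OF assms(3) compact_tube[OF assms(1)]])
      (use assms(2) in auto)
  have "norm (g (t, x, h) - g (t, z, k)) \<le> \<Lambda> * (norm (x - z) + \<bar>h - k\<bar>)"
    if "t \<in> {t0..T}" "norm (x - y t) \<le> r" "norm (z - y t) \<le> r" "h \<in> {0..h0}" "k \<in> {0..h0}"
    for t x z h k
  proof -
    have "norm (g (t, x, h) - g (t, z, k)) \<le> \<Lambda> * norm ((t, x, h) - (t, z, k))"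
      using that by (intro \<Lambda>(2)[of "{t} \<times> cball (y t) r \<times> {0..h0}"])
        (auto intro!: convex_Times simp: dist_norm norm_minus_commute)
    also have "\<dots> \<le> \<Lambda> * (norm (x - z) + \<bar>h - k\<bar>)"
      using norm_Pair_le[of "x - z" "h - k"] by (intro mult_left_mono \<Lambda>(1)) (simp add: norm_Pair)
    finally show ?thesis .
  qed
  with \<Lambda>(1) show thesis by (rule that)
qed

text \<open>By consistency the state derivative of \<open>\<Phi>\<close> at step size
  \<open>0\<close> is that of \<open>f\<close>. Derivatives of \<open>\<Phi>\<close> along fixed
  vectors are Lipschitz on time slices of the tube, so the state derivative at
  \<open>(t, x, h)\<close> differs from \<open>f'(y t)\<close> by at most
  \<open>K * (norm (x - y t) + h)\<close>; the mean value inequality gives the remainder.\<close>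

lemma method_linearization:
  fixes y :: "real \<Rightarrow> 'a::euclidean_space"
  assumes y: "continuous_on {t0..T} y"
    and r: "r > 0" "\<And>t x. t \<in> {t0..T} \<Longrightarrow> norm (x - y t) \<le> r \<Longrightarrow> (t, x) \<in> U"
    and "h0 > 0"
    and \<Phi>: "Ck_on 2 (\<lambda>(t, x, h). \<Phi> t x h) {(t, x, h). (t, x) \<in> U \<and> 0 \<le> h \<and> h \<le> h0}"
    and consistent: "\<And>t x. (t, x) \<in> U \<Longrightarrow> \<Phi> t x 0 = f x"
  obtains K where "K \<ge> 0"
    "\<And>t x h. t \<in> {t0..T} \<Longrightarrow> norm (x - y t) \<le> r \<Longrightarrow> h \<in> {0..h0} \<Longrightarrow>
       norm (\<Phi> t x h - \<Phi> t (y t) h - frechet_derivative f (at (y t)) (x - y t))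
         \<le> K * (norm (x - y t) + h) * norm (x - y t)"
proof -
  let ?S = "{(t, x, h). (t, x) \<in> U \<and> 0 \<le> h \<and> h \<le> h0}"
  obtain g' where g': "\<And>z. z \<in> ?S \<Longrightarrow> ((\<lambda>(t, x, h). \<Phi> t x h) has_derivative g' z) (at z within ?S)"
    and C1: "\<And>v. Ck_on 1 (\<lambda>z. g' z v) ?S"
    using \<Phi> by (auto simp: numeral_2_eq_2 simp del: Ck_on.simps(1))
  have "\<exists>\<Lambda>\<ge>0. \<forall>t x z h k. t \<in> {t0..T} \<longrightarrow> norm (x - y t) \<le> r \<longrightarrow> norm (z - y t) \<le> r \<longrightarrow>
       h \<in> {0..h0} \<longrightarrow> k \<in> {0..h0} \<longrightarrow>
       norm (g' (t, x, h) v - g' (t, z, k) v) \<le> \<Lambda> * (norm (x - z) + \<bar>h - k\<bar>)" for v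
    by (rule C1_on_tube_lipschitz[where r = r, OF y r(2) C1[of v]]) blast+
  then obtain \<Lambda> where \<Lambda>: "\<And>v. \<Lambda> v \<ge> 0"
    "\<And>v t x z h k. t \<in> {t0..T} \<Longrightarrow> norm (x - y t) \<le> r \<Longrightarrow> norm (z - y t) \<le> r \<Longrightarrow>
       h \<in> {0..h0} \<Longrightarrow> k \<in> {0..h0} \<Longrightarrow>
       norm (g' (t, x, h) v - g' (t, z, k) v) \<le> \<Lambda> v * (norm (x - z) + \<bar>h - k\<bar>)"
    by metis
  \<comment> \<open>Only the state is varied, so the Lipschitz constants along
    \<open>(0, b, 0)\<close> suffice.\<close>
  define K where "K = (\<Sum>b\<in>Basis. \<Lambda> (0, b, 0))"
  define D where "D t x h v = g' (t, x, h) (0, v, 0)" for t x h v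
  have D: "((\<lambda>x. \<Phi> t x h) has_derivative D t x h) (at x within cball (y t) r)"
    if "t \<in> {t0..T}" "x \<in> cball (y t) r" "h \<in> {0..h0}" for t x h
  proof -
    have "((\<lambda>x. (t, x, h)) has_derivative (\<lambda>v. (0, v, 0))) (at x within cball (y t) r)"
      by (auto intro!: derivative_eq_intros)
    moreover have "(\<lambda>x. (t, x, h)) ` cball (y t) r \<subseteq> ?S"
      using r(2) that by (auto simp: dist_norm norm_minus_commute)
    ultimately show ?thesis
      using has_derivative_in_compose2[OF g', of "\<lambda>x. (t, x, h)" "cball (y t) r" x] that
      by (simp add: D_def[abs_def])
  qed
  \<comment> \<open>\<open>D\<close> is a derivative within a closed ball. Passing to the open ball
    yields a full derivative, and there \<open>\<Phi> t x 0\<close> equals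
    \<open>f x\<close>.\<close>
  have f': "frechet_derivative f (at (y t)) = D t (y t) 0" if "t \<in> {t0..T}" for t
  proof -
    have "((\<lambda>x. \<Phi> t x 0) has_derivative D t (y t) 0) (at (y t) within ball (y t) r)"
      using D[of t "y t" 0] that r(1) \<open>h0 > 0\<close> by (auto intro: has_derivative_subset)
    then have "((\<lambda>x. \<Phi> t x 0) has_derivative D t (y t) 0) (at (y t))"
      using r(1) by (simp add: at_within_open[of _ "ball (y t) r"])
    then have "(f has_derivative D t (y t) 0) (at (y t))"
      using r that by (elim has_derivative_transform_within_open[where s = "ball (y t) r"])
        (auto intro!: consistent simp: dist_norm norm_minus_commute)
    then show ?thesis by (rule frechet_derivative_at[symmetric])
  qed
  have linear_D: "linear (D t x h)" if "t \<in> {t0..T}" "x \<in> cball (y t) r" "h \<in> {0..h0}" for t x h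
    using D[OF that] by (rule has_derivative_linear)
  have D_diff: "norm (D t x h v - D t (y t) 0 v) \<le> K * (norm (x - y t) + h) * norm v"
    if "t \<in> {t0..T}" "x \<in> cball (y t) r" "h \<in> {0..h0}" for t x h v
  proof -
    have "linear (\<lambda>v. D t x h v - D t (y t) 0 v)"
      using linear_D[of t x h] linear_D[of t "y t" 0] that r(1) \<open>h0 > 0\<close>
      by (intro linear_compose_sub) auto
    from linear_Basis_expansion[OF this, of v]
    have "norm (D t x h v - D t (y t) 0 v) =
        norm (\<Sum>b\<in>Basis. (v \<bullet> b) *\<^sub>R (D t x h b - D t (y t) 0 b))" by simp
    also have "\<dots> \<le> (\<Sum>b\<in>Basis. norm v * (\<Lambda> (0, b, 0) * (norm (x - y t) + h)))"
    proof (rule sum_norm_le)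
      fix b :: 'a assume b: "b \<in> Basis"
      have "norm (D t x h b - D t (y t) 0 b) \<le> \<Lambda> (0, b, 0) * (norm (x - y t) + \<bar>h - 0\<bar>)"
        unfolding D_def using that r(1) \<open>h0 > 0\<close>
        by (intro \<Lambda>(2)) (auto simp: dist_norm norm_minus_commute)
      then show "norm ((v \<bullet> b) *\<^sub>R (D t x h b - D t (y t) 0 b))
          \<le> norm v * (\<Lambda> (0, b, 0) * (norm (x - y t) + h))"
        using b that(3) by (auto intro!: mult_mono Basis_le_norm)
    qed
    also have "\<dots> = K * (norm (x - y t) + h) * norm v"
      by (simp add: K_def sum_distrib_left sum_distrib_right mult_ac)
    finally show ?thesis .
  qed
  have K0: "K \<ge> 0" using \<Lambda>(1) by (simp add: K_def sum_nonneg)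
  have "norm (\<Phi> t x h - \<Phi> t (y t) h - frechet_derivative f (at (y t)) (x - y t))
      \<le> K * (norm (x - y t) + h) * norm (x - y t)"
    if "t \<in> {t0..T}" "norm (x - y t) \<le> r" "h \<in> {0..h0}" for t x h
  proof -
    \<comment> \<open>The radius of \<open>?B\<close> is \<open>norm (x - y t)\<close> rather than
      \<open>r\<close>, so that the derivative bound on it shrinks as \<open>x\<close> approaches
      \<open>y t\<close>.\<close>
    let ?A = "D t (y t) 0" and ?B = "cball (y t) (norm (x - y t))"
    have sub: "?B \<subseteq> cball (y t) r" using that by auto
    have A: "bounded_linear ?A"
      using linear_D[of t "y t" 0] that r(1) \<open>h0 > 0\<close> by (simp add: linear_conv_bounded_linear)
    have "norm ((\<Phi> t x h - ?A x) - (\<Phi> t (y t) h - ?A (y t)))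
        \<le> K * (norm (x - y t) + h) * norm (x - y t)"
    proof (rule differentiable_bound[of ?B "\<lambda>x. \<Phi> t x h - ?A x" "\<lambda>z v. D t z h v - ?A v"])
      fix z assume z: "z \<in> ?B"
      show "((\<lambda>x. \<Phi> t x h - ?A x) has_derivative (\<lambda>v. D t z h v - ?A v)) (at z within ?B)"
        using z sub that D[of t z h]
        by (intro has_derivative_diff bounded_linear_imp_has_derivative[OF A])
          (auto intro: has_derivative_subset)
      show "onorm (\<lambda>v. D t z h v - ?A v) \<le> K * (norm (x - y t) + h)"
      proof (rule onorm_bound)
        show "0 \<le> K * (norm (x - y t) + h)" using K0 that(3) by simp
        fix v
        have "norm (D t z h v - ?A v) \<le> K * (norm (z - y t) + h) * norm v"
          using z sub that by (intro D_diff) auto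
        also have "\<dots> \<le> K * (norm (x - y t) + h) * norm v"
          using z K0 by (intro mult_right_mono mult_left_mono) (auto simp: dist_norm norm_minus_commute)
        finally show "norm (D t z h v - ?A v) \<le> K * (norm (x - y t) + h) * norm v" .
      qed
    qed (auto simp: dist_norm norm_minus_commute)
    moreover have "(\<Phi> t x h - ?A x) - (\<Phi> t (y t) h - ?A (y t)) = \<Phi> t x h - \<Phi> t (y t) h - ?A (x - y t)"
      using A by (simp add: linear_diff bounded_linear.linear)
    ultimately show ?thesis using f'[OF that(1)] by simp
  qed
  with K0 show thesis by (rule that)
qed

text \<open>Mean value inequality for \<open>\<lambda>s. e s - s *\<^sub>R e' t\<close>, whose
  derivative on \<open>{t..t + h}\<close> has norm at most \<open>M * h\<close>.\<close>

lemma vector_derivative_quadratic_remainder: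
  fixes e :: "real \<Rightarrow> 'a::euclidean_space"
  assumes "\<And>t. t \<in> {a..b} \<Longrightarrow> (e has_vector_derivative e' t) (at t within {a..b})"
    and "\<And>s t. s \<in> {a..b} \<Longrightarrow> t \<in> {a..b} \<Longrightarrow> norm (e' s - e' t) \<le> M * \<bar>s - t\<bar>"
    and "M \<ge> 0" "h \<ge> 0" "t \<in> {a..b}" "t + h \<in> {a..b}"
  shows "norm (e (t + h) - e t - h *\<^sub>R e' t) \<le> M * h\<^sup>2"
proof -
  let ?I = "{t..t + h}"
  have "norm ((e (t + h) - (t + h) *\<^sub>R e' t) - (e t - t *\<^sub>R e' t)) \<le> (M * h) * norm ((t + h) - t)"
  proof (rule differentiable_bound[of ?I "\<lambda>s. e s - s *\<^sub>R e' t" "\<lambda>s u. u *\<^sub>R e' s - u *\<^sub>R e' t"])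
    fix s assume s: "s \<in> ?I"
    have "(e has_derivative (\<lambda>u. u *\<^sub>R e' s)) (at s within ?I)"
      using assms(1)[of s] assms(5,6) s unfolding has_vector_derivative_def
      by (intro has_derivative_subset[where s = "{a..b}" and t = ?I]) auto
    then show "((\<lambda>s. e s - s *\<^sub>R e' t) has_derivative (\<lambda>u. u *\<^sub>R e' s - u *\<^sub>R e' t)) (at s within ?I)"
      by (auto intro!: derivative_eq_intros)
    show "onorm (\<lambda>u. u *\<^sub>R e' s - u *\<^sub>R e' t) \<le> M * h"
    proof (rule onorm_bound)
      fix u :: real
      have "norm (e' s - e' t) \<le> M * \<bar>s - t\<bar>" using assms(4-6) s by (intro assms(2)) auto
      also have "\<dots> \<le> M * h" using assms s by (intro mult_left_mono) auto
      finally show "norm (u *\<^sub>R e' s - u *\<^sub>R e' t) \<le> M * h * norm u"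
        by (simp add: scaleR_diff_right[symmetric] mult.commute[of "\<bar>u\<bar>"] mult_right_mono)
    qed (use assms in simp)
  qed (use assms in auto)
  then show ?thesis using assms by (simp add: algebra_simps power2_eq_square)
qed

text \<open>With \<open>d\<close> and \<open>e\<close> left general, one statement covers the first
  method with \<open>d\<close>, \<open>e\<close> and the second with both multiplied by
  \<open>\<gamma>\<close>.\<close>

lemma global_error_expansion:
  fixes f :: "'a::euclidean_space \<Rightarrow> 'a"
  assumes "p \<ge> 1" "t0 < T"
    and y: "continuous_on {t0..T} y" "y t0 = y0"
    and U: "open U" "\<And>t. t \<in> {t0..T} \<Longrightarrow> (t, y t) \<in> U"
    and f_differentiable: "\<And>t. t \<in> {t0..T} \<Longrightarrow> f differentiable (at (y t))"
    and "h0 > 0"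
    and \<Phi>: "Ck_on 2 (\<lambda>(t, x, h). \<Phi> t x h) {(t, x, h). (t, x) \<in> U \<and> 0 \<le> h \<and> h \<le> h0}"
    and consistent: "\<And>t x. (t, x) \<in> U \<Longrightarrow> \<Phi> t x 0 = f x"
    and local_error: "\<exists>C. \<forall>\<^sub>F h in at_right 0. \<forall>t\<in>{t0..T - h}.
      norm (y (t + h) - y t - h *\<^sub>R \<Phi> t (y t) h - h ^ (p + 1) *\<^sub>R d t) \<le> C * h ^ (p + 2)"
    and e: "solves_ode e (\<lambda>t v. frechet_derivative f (at (y t)) v + d t) t0 T" "e t0 = 0"
    and rhs_C1: "Ck_on 1 (\<lambda>t. frechet_derivative f (at (y t)) (e t) + d t) {t0..T}"
  shows "\<exists>C. \<forall>\<^sub>F h in at_right 0. \<forall>n. t0 + real n * h \<le> T \<longrightarrow>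
      norm (y (t0 + real n * h) - one_step \<Phi> t0 y0 h n - h ^ p *\<^sub>R e (t0 + real n * h)) \<le> C * h ^ (p + 1)"
proof -
  let ?A = "\<lambda>t. frechet_derivative f (at (y t))"
  obtain r where r: "r > 0" "\<And>t x. t \<in> {t0..T} \<Longrightarrow> norm (x - y t) \<le> r \<Longrightarrow> (t, x) \<in> U"
    using obtain_tube[OF y(1) U] by blast
  have "Ck_on 1 (\<lambda>(t, x, h). \<Phi> t x h) {(t, x, h). (t, x) \<in> U \<and> 0 \<le> h \<and> h \<le> h0}"
    by (rule Ck_on_le[OF \<Phi>]) simp
  from C1_on_tube_lipschitz[where r = r, OF y(1) r(2) this]
  obtain \<Lambda> where \<Lambda>: "\<Lambda> \<ge> 0"
    "\<And>t x z h k. t \<in> {t0..T} \<Longrightarrow> norm (x - y t) \<le> r \<Longrightarrow> norm (z - y t) \<le> r \<Longrightarrow>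
       h \<in> {0..h0} \<Longrightarrow> k \<in> {0..h0} \<Longrightarrow>
       norm (\<Phi> t x h - \<Phi> t z k) \<le> \<Lambda> * (norm (x - z) + \<bar>h - k\<bar>)"
    by auto
  obtain K where K: "K \<ge> 0"
    "\<And>t x h. t \<in> {t0..T} \<Longrightarrow> norm (x - y t) \<le> r \<Longrightarrow> h \<in> {0..h0} \<Longrightarrow>
       norm (\<Phi> t x h - \<Phi> t (y t) h - ?A t (x - y t)) \<le> K * (norm (x - y t) + h) * norm (x - y t)"
    using method_linearization[OF y(1) r \<open>h0 > 0\<close> \<Phi> consistent] by blast
  have e': "(e has_vector_derivative ?A t (e t) + d t) (at t within {t0..T})" if "t \<in> {t0..T}" for t
    using e(1) that by (simp add: solves_ode_def)
  have linear_A: "linear (?A t)" if "t \<in> {t0..T}" for t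
    using f_differentiable[OF that] by (rule linear_frechet_derivative)
  obtain M where M: "M \<ge> 0"
    "\<And>C s t. convex C \<Longrightarrow> C \<subseteq> {t0..T} \<Longrightarrow> s \<in> C \<Longrightarrow> t \<in> C \<Longrightarrow>
       norm ((?A s (e s) + d s) - (?A t (e t) + d t)) \<le> M * norm (s - t)"
    using C1_on_uniform_lipschitz[OF rhs_C1 compact_Icc order_refl] by blast
  have remainder: "norm (e (t + h) - e t - h *\<^sub>R (?A t (e t) + d t)) \<le> M * h\<^sup>2"
    if "h \<ge> 0" "t \<in> {t0..T}" "t + h \<in> {t0..T}" for t h
    using M(2)[of "{t0..T}"] that
    by (intro vector_derivative_quadratic_remainder[OF e' _ M(1)]) auto
  have "continuous_on {t0..T} e"
    using e' has_vector_derivative_continuous by (metis continuous_on_eq_continuous_within)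
  then have "bounded (e ` {t0..T})"
    by (intro compact_imp_bounded compact_continuous_image) auto
  then obtain B where B: "B > 0" "\<And>t. t \<in> {t0..T} \<Longrightarrow> norm (e t) \<le> B"
    by (auto simp: bounded_pos)
  obtain C where C: "\<forall>\<^sub>F h in at_right 0. \<forall>t\<in>{t0..T - h}.
      norm (y (t + h) - y t - h *\<^sub>R \<Phi> t (y t) h - h ^ (p + 1) *\<^sub>R d t) \<le> C * h ^ (p + 2)"
    using local_error by blast
  \<comment> \<open>The summands bound, in units of \<open>h ^ (p + 2)\<close>, the local error
    remainder, the linearization remainder of \<open>\<Phi>\<close> and the Taylor remainder of
    \<open>e\<close>.\<close>
  define R where "R = \<bar>C\<bar> + K * (B + 1) * B + M"
  \<comment> \<open>At most \<open>(T - t0) / h\<close> residuals accumulate, each amplified by at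
    most \<open>exp (\<Lambda> * (T - t0))\<close>.\<close>
  define D where "D = (T - t0) * R * exp (\<Lambda> * (T - t0))"
  have R: "R \<ge> 0" using K(1) B(1) M(1) by (simp add: R_def)
  have D: "D \<ge> 0" using R \<open>t0 < T\<close> by (simp add: D_def)
  \<comment> \<open>The entry \<open>1\<close> gives \<open>h ^ p \<le> h\<close>. The entries with
    \<open>r\<close> keep the corrected solution within \<open>r / 2\<close> of \<open>y\<close> and
    the numerical one within \<open>r / 2\<close> of the corrected one, hence both in the tube.
    \<open>D + 1\<close> keeps the denominator positive when \<open>D = 0\<close>.\<close>
  define hmax where "hmax = Min {1, h0, r / (2 * (D + 1)), r / (2 * B)}"
  have "hmax > 0" using \<open>h0 > 0\<close> r(1) B(1) D by (auto simp: hmax_def)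
  then have "\<forall>\<^sub>F h in at_right 0. h \<in> {0<..<hmax}" by (rule eventually_at_right_real)
  with C have "\<forall>\<^sub>F h in at_right 0. \<forall>n. t0 + real n * h \<le> T \<longrightarrow>
      norm (y (t0 + real n * h) - one_step \<Phi> t0 y0 h n - h ^ p *\<^sub>R e (t0 + real n * h)) \<le> D * h ^ (p + 1)"
  proof eventually_elim
    case (elim h)
    have h: "h > 0" "h \<le> 1" "h \<le> h0" "h * D \<le> r / 2" "h * B \<le> r / 2"
    proof -
      show "h > 0" "h \<le> 1" "h \<le> h0" using elim(2) by (auto simp: hmax_def)
      have "h \<le> r / (2 * B)" "h \<le> r / (2 * (D + 1))" using elim(2) by (auto simp: hmax_def)
      then have "h * (D + 1) \<le> r / 2" and "h * B \<le> r / 2"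
        using B(1) D by (auto simp: field_simps)
      then show "h * D \<le> r / 2" "h * B \<le> r / 2" using \<open>h > 0\<close> by (auto simp: algebra_simps)
    qed
    have hp: "h ^ p \<le> h" using power_decreasing[OF \<open>p \<ge> 1\<close>, of h] h by simp
    have hp1: "h ^ (p + 1) \<le> h" using power_decreasing[of 1 "p + 1" h] h by simp
    let ?w = "\<lambda>t. y t - h ^ p *\<^sub>R e t"
    have w_y: "norm (?w t - y t) \<le> h ^ p * B" if "t \<in> {t0..T}" for t
      using B(2)[OF that] h(1) by (simp add: mult_left_mono)
    have hpB: "h ^ p * B \<le> h * B" using hp B(1) by (intro mult_right_mono) auto
    have w_tube: "norm (?w t - y t) \<le> r / 2" if "t \<in> {t0..T}" for t
      using w_y[OF that] hpB h(5) by linarith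
    have residual: "norm (?w (t + h) - ?w t - h *\<^sub>R \<Phi> t (?w t) h) \<le> R * h ^ (p + 2)"
      if t: "t \<in> {t0..T}" "t + h \<in> {t0..T}" for t
    proof -
      let ?R1 = "y (t + h) - y t - h *\<^sub>R \<Phi> t (y t) h - h ^ (p + 1) *\<^sub>R d t"
      let ?R2 = "\<Phi> t (?w t) h - \<Phi> t (y t) h - ?A t (?w t - y t)"
      let ?R3 = "e (t + h) - e t - h *\<^sub>R (?A t (e t) + d t)"
      have "?A t (?w t - y t) = - (h ^ p *\<^sub>R ?A t (e t))"
        using linear_A[OF t(1)] by (simp add: linear_neg linear_scale)
      \<comment> \<open>The equation for \<open>e\<close> acts here: \<open>d t\<close> from
        \<open>?R1\<close> and \<open>?A t (e t)\<close> from \<open>?R2\<close> cancel against the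
        derivative of \<open>e\<close> inside \<open>?R3\<close>.\<close>
      then have "?w (t + h) - ?w t - h *\<^sub>R \<Phi> t (?w t) h = ?R1 - h *\<^sub>R ?R2 - h ^ p *\<^sub>R ?R3"
        by (simp add: algebra_simps)
      moreover have "norm (u - h *\<^sub>R v - h ^ p *\<^sub>R x) \<le> norm u + h * norm v + h ^ p * norm x"
        for u v x :: 'a
        using norm_triangle_ineq4[of "u - h *\<^sub>R v" "h ^ p *\<^sub>R x"]
          norm_triangle_ineq4[of u "h *\<^sub>R v"] h(1) by simp
      ultimately have "norm (?w (t + h) - ?w t - h *\<^sub>R \<Phi> t (?w t) h) \<le>
          norm ?R1 + h * norm ?R2 + h ^ p * norm ?R3"
        by (simp only:)
      also have "\<dots> \<le> \<bar>C\<bar> * h ^ (p + 2) + h * (K * (B + 1) * B * h ^ (p + 1)) + h ^ p * (M * h\<^sup>2)"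
      proof (intro add_mono mult_left_mono)
        have "norm ?R1 \<le> C * h ^ (p + 2)" using elim(1) t by auto
        also have "\<dots> \<le> \<bar>C\<bar> * h ^ (p + 2)" using h(1) by (intro mult_right_mono) auto
        finally show "norm ?R1 \<le> \<bar>C\<bar> * h ^ (p + 2)" .
        define \<delta> where "\<delta> = norm (?w t - y t)"
        have \<delta>: "0 \<le> \<delta>" "\<delta> \<le> h ^ p * B" "\<delta> \<le> h * B"
          unfolding \<delta>_def using order_trans[OF w_y[OF t(1)] hpB] w_y[OF t(1)] by simp_all
        have "norm ?R2 \<le> K * (\<delta> + h) * \<delta>"
          unfolding \<delta>_def using w_tube[OF t(1)] r(1) h t by (intro K(2)) auto
        \<comment> \<open>One \<open>\<delta>\<close> is estimated by \<open>h * B\<close>, which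
          rests on \<open>p \<ge> 1\<close>; the other keeps \<open>h ^ p * B\<close>, for total
          order \<open>p + 1\<close>.\<close>
        also have "\<dots> \<le> K * (h * B + h) * (h ^ p * B)"
          using \<delta> K(1) h(1) B(1) by (intro mult_mono mult_left_mono add_mono) auto
        also have "\<dots> = K * (B + 1) * B * h ^ (p + 1)" by (simp add: algebra_simps)
        finally show "norm ?R2 \<le> K * (B + 1) * B * h ^ (p + 1)" .
        show "norm ?R3 \<le> M * h\<^sup>2" using remainder h(1) t by simp
      qed (use h in auto)
      also have "\<dots> = R * h ^ (p + 2)"
        by (simp add: R_def algebra_simps power2_eq_square)
      finally show ?thesis .
    qed
    show ?case
    proof (intro allI impI)
      fix n assume n: "t0 + real n * h \<le> T"
      have grid: "t0 + real k * h \<in> {t0..T}" if "k \<le> n" for k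
      proof -
        have "real k * h \<le> real n * h" using that h(1) by (intro mult_right_mono) auto
        then have "t0 + real k * h \<le> T" using n by linarith
        then show ?thesis using h(1) by simp
      qed
      \<comment> \<open>By \<open>1 + x \<le> exp x\<close>. Next, one factor \<open>h\<close> joins
        \<open>n\<close> to form the elapsed time \<open>real n * h\<close>, at most
        \<open>T - t0\<close>, which costs one order.\<close>
      have "real n * (R * h ^ (p + 2)) * (1 + h * \<Lambda>) ^ n \<le> real n * (R * h ^ (p + 2)) * exp (h * \<Lambda>) ^ n"
        using h(1) \<Lambda>(1) R by (intro mult_left_mono power_mono) auto
      also have "\<dots> = (real n * h) * R * exp (\<Lambda> * (real n * h)) * h ^ (p + 1)"
        by (simp add: exp_of_nat_mult[symmetric] mult_ac)
      also have "\<dots> \<le> D * h ^ (p + 1)"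
        unfolding D_def using h(1) \<Lambda>(1) R n \<open>t0 < T\<close>
        by (intro mult_right_mono mult_mono iffD2[OF exp_le_cancel_iff]) auto
      finally have D_bound: "real n * (R * h ^ (p + 2)) * (1 + h * \<Lambda>) ^ n \<le> D * h ^ (p + 1)" .
      have "D * h ^ (p + 1) \<le> r / 2"
        using mult_left_mono[OF hp1 D] h(4) by (simp add: mult.commute)
      \<comment> \<open>The stability estimate starts from \<open>?w t0 = y0\<close>, which holds
        because \<open>e t0 = 0\<close>.\<close>
      have "norm (?w (t0 + real n * h) - one_step \<Phi> t0 y0 h n)
          \<le> real n * (R * h ^ (p + 2)) * (1 + h * \<Lambda>) ^ n"
      proof (rule one_step_stability[where N = n and s = "r / 2" and w = "\<lambda>k. ?w (t0 + real k * h)"])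
        fix k x assume k: "k < n"
        let ?t = "t0 + real k * h"
        have t: "?t \<in> {t0..T}" "?t + h \<in> {t0..T}" and Suc: "t0 + real (Suc k) * h = ?t + h"
          using grid[of k] grid[of "Suc k"] k by (auto simp: algebra_simps)
        from residual[OF t]
        show "norm (?w (t0 + real (Suc k) * h) - ?w ?t - h *\<^sub>R \<Phi> ?t (?w ?t) h) \<le> R * h ^ (p + 2)"
          unfolding Suc .
        assume x: "norm (?w ?t - x) \<le> r / 2"
        have "norm (x - y ?t) \<le> norm (?w ?t - x) + norm (?w ?t - y ?t)"
          using norm_triangle_ineq4[of "?w ?t - y ?t" "?w ?t - x"] by simp
        then have "norm (x - y ?t) \<le> r" using x w_tube[OF t(1)] by linarith
        then show "norm (\<Phi> ?t (?w ?t) h - \<Phi> ?t x h) \<le> \<Lambda> * norm (?w ?t - x)"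
          using \<Lambda>(2)[OF t(1), of "?w ?t" x h h] w_tube[OF t(1)] r(1) h by simp
      next
        show "real n * (R * h ^ (p + 2)) * (1 + h * \<Lambda>) ^ n \<le> r / 2"
          using D_bound \<open>D * h ^ (p + 1) \<le> r / 2\<close> by (rule order_trans)
      qed (use h(1) \<Lambda>(1) R y(2) e(2) in auto)
      from order_trans[OF this D_bound]
      show "norm (y (t0 + real n * h) - one_step \<Phi> t0 y0 h n
          - h ^ p *\<^sub>R e (t0 + real n * h)) \<le> D * h ^ (p + 1)"
        by (simp only: diff_diff_eq add.commute)
    qed
  qed
  then show ?thesis by blast
qed

section \<open>The error estimate from the expansions of both methods\<close>

theorem theorem2p9:
  fixes f :: "'a::euclidean_space \<Rightarrow> 'a"
    and \<Phi> \<Psi> :: "real \<Rightarrow> 'a \<Rightarrow> real \<Rightarrow> 'a"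
    and y d e :: "real \<Rightarrow> 'a"
    and y0 :: 'a
    and U :: "(real \<times> 'a) set"
    and t0 T h0 L \<gamma> :: real
    and a :: "rtree \<Rightarrow> real"
    and p :: nat
  assumes p: "p \<ge> 1"
    and "t0 < T"
    and y: "solves_ode y (\<lambda>_. f) t0 T" "y t0 = y0"
    and U: "open U" "\<And>t. t \<in> {t0..T} \<Longrightarrow> (t, y t) \<in> U"
    and f_smooth: "Ck_on (p + 1) f (snd ` U)"
    and f_lipschitz: "\<And>t x z. (t, x) \<in> U \<Longrightarrow> (t, z) \<in> U \<Longrightarrow> norm (f x - f z) \<le> L * norm (x - z)"
    and "h0 > 0"
    and \<Phi>: "admissible_method U h0 f (p + 1) p \<Phi>"
    and \<Psi>: "admissible_method U h0 f (p + 1) p \<Psi>"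
    and d: "\<And>t. t \<in> {t0..T} \<Longrightarrow>
      d t = (1 / fact (p + 1)) *\<^sub>R
        (\<Sum>\<tau>\<in>rooted_trees (p + 1). (real (alpha \<tau>) * a \<tau>) *\<^sub>R elem_diff f \<tau> (y t))"
    and "\<gamma> \<noteq> 1"
    and local_error: "\<exists>C. \<forall>\<^sub>F h in at_right 0. \<forall>t\<in>{t0..T - h}.
      norm (y (t + h) - y t - h *\<^sub>R \<Phi> t (y t) h - h ^ (p + 1) *\<^sub>R d t) \<le> C * h ^ (p + 2)"
    and local_error': "\<exists>C. \<forall>\<^sub>F h in at_right 0. \<forall>t\<in>{t0..T - h}.
      norm (y (t + h) - y t - h *\<^sub>R \<Psi> t (y t) h - h ^ (p + 1) *\<^sub>R (\<gamma> *\<^sub>R d t)) \<le> C * h ^ (p + 2)"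
    and e: "solves_ode e (\<lambda>t v. frechet_derivative f (at (y t)) v + d t) t0 T" "e t0 = 0"
  defines "\<epsilon> \<equiv> \<lambda>h n. y (t0 + real n * h) - one_step \<Phi> t0 y0 h n"
    and "\<epsilon>\<^sub>p \<equiv> \<lambda>h n. (1 / (1 - \<gamma>)) *\<^sub>R (one_step \<Psi> t0 y0 h n - one_step \<Phi> t0 y0 h n)"
  shows
    "(\<exists>C. \<forall>\<^sub>F h in at_right 0. \<forall>n. t0 + real n * h \<le> T \<longrightarrow>
        norm (\<epsilon>\<^sub>p h n - h ^ p *\<^sub>R e (t0 + real n * h)) \<le> C * h ^ (p + 1)) \<and>
     (\<exists>C. \<forall>\<^sub>F h in at_right 0. \<forall>n. t0 + real n * h \<le> T \<longrightarrow>
        norm (\<epsilon>\<^sub>p h n - \<epsilon> h n) \<le> C * h ^ (p + 1))"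
proof -
  let ?A = "\<lambda>t. frechet_derivative f (at (y t))"
  have y': "(y has_vector_derivative f (y t)) (at t within {t0..T})" if "t \<in> {t0..T}" for t
    using y(1) that by (simp add: solves_ode_def)
  have e': "(e has_vector_derivative ?A t (e t) + d t) (at t within {t0..T})" if "t \<in> {t0..T}" for t
    using e(1) that by (simp add: solves_ode_def)
  have cont_y: "continuous_on {t0..T} y" and cont_e: "continuous_on {t0..T} e"
    using y' e' has_vector_derivative_continuous by (metis continuous_on_eq_continuous_within)+
  have open_V: "open (snd ` U)" using U(1) by (rule open_image_snd)
  have y_V: "y ` {t0..T} \<subseteq> snd ` U" using U(2) by force
  have f_C1: "Ck_on 1 f (snd ` U)" and f_C2: "Ck_on (Suc 1) f (snd ` U)"
    using p by (auto intro: Ck_on_le[OF f_smooth] simp del: Ck_on.simps)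
  have f_diff: "f differentiable (at (y t))" if "t \<in> {t0..T}" for t
    using Ck_on_differentiable[OF open_V f_C2] y_V that by blast
  have y_C1: "Ck_on 1 y {t0..T}"
  proof (rule C1_on_vector_derivative)
    show "continuous_on {t0..T} (\<lambda>t. f (y t))"
      by (rule continuous_on_compose2[OF C1_on_imp_continuous_on[OF f_C1] cont_y y_V])
  qed (rule y')
  \<comment> \<open>The vertex count \<open>p + 1\<close> equals the assumed smoothness order of
    \<open>f\<close>, the limiting case of the bound on trees.\<close>
  have "Ck_on 1 (\<lambda>t. elem_diff f \<tau> (y t)) {t0..T}" if "\<tau> \<in> rooted_trees (p + 1)" for \<tau>
    using that C1_on_elem_diff[OF open_V f_smooth, of \<tau>]
    by (intro C1_on_compose[OF _ y_C1 y_V]) (simp add: rooted_trees_def del: Ck_on.simps)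
  then have "Ck_on 1 (\<lambda>t. (1 / fact (p + 1)) *\<^sub>R
      (\<Sum>\<tau>\<in>rooted_trees (p + 1). (real (alpha \<tau>) * a \<tau>) *\<^sub>R elem_diff f \<tau> (y t))) {t0..T}"
    by (intro C1_on_scaleR C1_on_sum C1_on_const)
  then have d_C1: "Ck_on 1 d {t0..T}"
    by (rule Ck_on_transform) (rule d)
  have rhs_eq: "?A t (e t) + d t = (\<Sum>b\<in>Basis. (e t \<bullet> b) *\<^sub>R ?A t b) + d t" if "t \<in> {t0..T}" for t
    using linear_Basis_expansion[OF linear_frechet_derivative[OF f_diff[OF that]], of "e t"] by simp
  have A_C1: "Ck_on 1 (\<lambda>t. ?A t b) {t0..T}" for b
    using C1_on_compose[OF Ck_on_frechet_derivative[OF open_V f_C2] y_C1 y_V] .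
  \<comment> \<open>Bootstrapping: continuity of \<open>e\<close> makes the right-hand side of its
    equation continuous, so \<open>e\<close> is continuously differentiable, and then so is the
    right-hand side.\<close>
  have "continuous_on {t0..T} (\<lambda>t. (\<Sum>b\<in>Basis. (e t \<bullet> b) *\<^sub>R ?A t b) + d t)"
    by (intro continuous_intros cont_e C1_on_imp_continuous_on[OF A_C1] C1_on_imp_continuous_on[OF d_C1])
  then have "continuous_on {t0..T} (\<lambda>t. ?A t (e t) + d t)"
    by (rule continuous_on_eq) (rule rhs_eq[symmetric])
  then have e_C1: "Ck_on 1 e {t0..T}"
    by (intro C1_on_vector_derivative[of "{t0..T}" e "\<lambda>t. ?A t (e t) + d t"] e')
  have "Ck_on 1 (\<lambda>t. (\<Sum>b\<in>Basis. (e t \<bullet> b) *\<^sub>R ?A t b) + d t) {t0..T}"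
    by (intro C1_on_add C1_on_sum C1_on_scaleR C1_on_inner_const e_C1 A_C1 d_C1)
  then have rhs_C1: "Ck_on 1 (\<lambda>t. ?A t (e t) + d t) {t0..T}"
    by (rule Ck_on_transform) (rule rhs_eq)
  \<comment> \<open>The equation for \<open>e\<close> is linear, so multiplying the forcing
    \<open>d\<close> by \<open>\<gamma>\<close> multiplies the solution by
    \<open>\<gamma>\<close>.\<close>
  have scaled: "?A t (\<gamma> *\<^sub>R e t) + \<gamma> *\<^sub>R d t = \<gamma> *\<^sub>R (?A t (e t) + d t)" if "t \<in> {t0..T}" for t
    using linear_frechet_derivative[OF f_diff[OF that]] by (simp add: linear_scale scaleR_add_right)
  have \<gamma>e: "solves_ode (\<lambda>t. \<gamma> *\<^sub>R e t) (\<lambda>t v. ?A t v + \<gamma> *\<^sub>R d t) t0 T"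
    unfolding solves_ode_def
    using e' scaled by (auto intro!: derivative_eq_intros)
  have \<gamma>_rhs_C1: "Ck_on 1 (\<lambda>t. ?A t (\<gamma> *\<^sub>R e t) + \<gamma> *\<^sub>R d t) {t0..T}"
    by (rule Ck_on_transform[OF C1_on_scaleR[OF C1_on_const rhs_C1]]) (rule scaled)
  \<comment> \<open>Order \<open>2\<close> is available since \<open>p + 1 \<ge> 2\<close>.\<close>
  have \<Phi>': "Ck_on 2 (\<lambda>(t, x, h). \<Phi> t x h) {(t, x, h). (t, x) \<in> U \<and> 0 \<le> h \<and> h \<le> h0}"
    "\<And>t x. (t, x) \<in> U \<Longrightarrow> \<Phi> t x 0 = f x"
    using \<Phi> p by (auto simp: admissible_method_def simp del: Ck_on.simps intro: Ck_on_le)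
  have \<Psi>': "Ck_on 2 (\<lambda>(t, x, h). \<Psi> t x h) {(t, x, h). (t, x) \<in> U \<and> 0 \<le> h \<and> h \<le> h0}"
    "\<And>t x. (t, x) \<in> U \<Longrightarrow> \<Psi> t x 0 = f x"
    using \<Psi> p by (auto simp: admissible_method_def simp del: Ck_on.simps intro: Ck_on_le)
  obtain C1 where C1: "\<forall>\<^sub>F h in at_right 0. \<forall>n. t0 + real n * h \<le> T \<longrightarrow>
      norm (\<epsilon> h n - h ^ p *\<^sub>R e (t0 + real n * h)) \<le> C1 * h ^ (p + 1)"
    using global_error_expansion[OF p \<open>t0 < T\<close> cont_y y(2) U f_diff \<open>h0 > 0\<close> \<Phi>' local_error e rhs_C1]
    unfolding \<epsilon>_def by blast
  obtain C2 where C2: "\<forall>\<^sub>F h in at_right 0. \<forall>n. t0 + real n * h \<le> T \<longrightarrow>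
      norm (y (t0 + real n * h) - one_step \<Psi> t0 y0 h n - h ^ p *\<^sub>R (\<gamma> *\<^sub>R e (t0 + real n * h)))
        \<le> C2 * h ^ (p + 1)"
    using global_error_expansion[OF p \<open>t0 < T\<close> cont_y y(2) U f_diff \<open>h0 > 0\<close> \<Psi>' local_error' \<gamma>e _ \<gamma>_rhs_C1]
      e(2) by auto
  define c where "c = \<bar>1 / (1 - \<gamma>)\<bar>"
  have estimate: "\<forall>\<^sub>F h in at_right 0. \<forall>n. t0 + real n * h \<le> T \<longrightarrow>
      norm (\<epsilon>\<^sub>p h n - h ^ p *\<^sub>R e (t0 + real n * h)) \<le> c * (C1 + C2) * h ^ (p + 1)"
    using C1 C2
  proof eventually_elim
    case (elim h)
    show ?case
    proof (intro allI impI)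
      fix n assume n: "t0 + real n * h \<le> T"
      let ?t = "t0 + real n * h"
      let ?E1 = "\<epsilon> h n - h ^ p *\<^sub>R e ?t"
      let ?E2 = "y ?t - one_step \<Psi> t0 y0 h n - h ^ p *\<^sub>R (\<gamma> *\<^sub>R e ?t)"
      let ?k = "1 / (1 - \<gamma>)"
      \<comment> \<open>The exact solution cancels in \<open>?E1 - ?E2\<close>, leaving the leading
        coefficient \<open>1 - \<gamma>\<close>, which \<open>?k\<close> normalizes to
        \<open>1\<close>.\<close>
      have "?k *\<^sub>R (?E1 - ?E2) = ?k *\<^sub>R
          ((one_step \<Psi> t0 y0 h n - one_step \<Phi> t0 y0 h n) - (h ^ p * (1 - \<gamma>)) *\<^sub>R e ?t)"
        by (simp add: \<epsilon>_def algebra_simps)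
      also have "\<dots> = \<epsilon>\<^sub>p h n - (?k * (h ^ p * (1 - \<gamma>))) *\<^sub>R e ?t"
        by (simp only: \<epsilon>\<^sub>p_def scaleR_diff_right[of ?k] scaleR_scaleR)
      also have "?k * (h ^ p * (1 - \<gamma>)) = h ^ p"
        using \<open>\<gamma> \<noteq> 1\<close> by simp
      finally have "norm (\<epsilon>\<^sub>p h n - h ^ p *\<^sub>R e ?t) = c * norm (?E1 - ?E2)"
        unfolding c_def by (metis norm_scaleR)
      also have "\<dots> \<le> c * (C1 * h ^ (p + 1) + C2 * h ^ (p + 1))"
        using elim n by (intro mult_left_mono order_trans[OF norm_triangle_ineq4 add_mono])
          (auto simp: c_def)
      finally show "norm (\<epsilon>\<^sub>p h n - h ^ p *\<^sub>R e ?t) \<le> c * (C1 + C2) * h ^ (p + 1)"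
        by (simp add: algebra_simps)
    qed
  qed
  \<comment> \<open>Estimator and true error share the leading term
    \<open>h ^ p *\<^sub>R e\<close>, so the triangle inequality compares them.\<close>
  from estimate C1 have "\<forall>\<^sub>F h in at_right 0. \<forall>n. t0 + real n * h \<le> T \<longrightarrow>
      norm (\<epsilon>\<^sub>p h n - \<epsilon> h n) \<le> (c * (C1 + C2) + C1) * h ^ (p + 1)"
  proof eventually_elim
    case (elim h)
    show ?case
    proof (intro allI impI)
      fix n assume n: "t0 + real n * h \<le> T"
      let ?l = "h ^ p *\<^sub>R e (t0 + real n * h)"
      have "norm (\<epsilon>\<^sub>p h n - \<epsilon> h n) \<le> norm (\<epsilon>\<^sub>p h n - ?l) + norm (\<epsilon> h n - ?l)"
        using norm_triangle_ineq4[of "\<epsilon>\<^sub>p h n - ?l" "\<epsilon> h n - ?l"] by simp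
      also have "\<dots> \<le> c * (C1 + C2) * h ^ (p + 1) + C1 * h ^ (p + 1)"
        using elim n by (intro add_mono) auto
      finally show "norm (\<epsilon>\<^sub>p h n - \<epsilon> h n) \<le> (c * (C1 + C2) + C1) * h ^ (p + 1)"
        by (simp add: distrib_right)
    qed
  qed
  with estimate show ?thesis by blast
qed

end
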